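(* Let $d\ge 1$, let $r\in(0,\infty)$, and let $\mathcal G=(\mathcal V,\mathcal E)$ be a finite undirected graph with vertex set $\mathcal V=\{1,\dots,|\mathcal V|\}$, $|\mathcal V|\ge 1$. Let $\mathcal X=(x_i)_{i\in\mathcal V}$ be positions in $\mathbb R^d$ such that $(\mathcal G,\mathcal X,r)$ is a geometric graph, i.e. for all distinct $i,j\in\mathcal V$, $(i,j)\in\mathcal E$ if and only if $\|x_i-x_j\|\le r$. Let $\varphi(\mathcal G,\mathcal X)$ denote the bandwidth achieved on $\mathcal G$ by the vertex relabeling algorithm (sorting the vertices by the coordinates of their positions). Then $$\varphi(\mathcal G,\mathcal X)\ \le\ \max_{a\in\mathbb R}\big|\mathcal X\cap R_{\mathrm x}(a,a+r)\big| \ =:\ \varphi_{\max}(\mathcal X,r),$$ where $R_{\mathrm x}(a_1,a_2):=[a_1,a_2]\times\mathbb R^{d-1}$.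
   Context: $\|\cdot\|$ is the Euclidean norm. Vertex relabeling algorithm: given positions $\mathcal X=(x_i)_{i\in\mathcal V}$ in $\mathbb R^d$, sort the vertices in increasing order of the first coordinate (the $\mathrm x$-coordinate) of $x_i$, resolving ties by the second coordinate, and so on (i.e. lexicographically; vertices with identical positions may be ordered arbitrarily). This yields a bijection $\pi:\mathcal V\to\mathcal V$, where $\pi(i)$ is the rank of vertex $i$ in the sorted order. The bandwidth of an $n\times n$ matrix $A$ is $\max_{A_{ij}\ne 0}|i-j|$ (equal to $0$ if $A=0$). The Laplacian $\mathcal L$ of a graph has $\mathcal L_{ii}=$ number of neighbors of $i$, $\mathcal L_{ij}=-1$ if $(i,j)\in\mathcal E$ with $i\neq j$, and $\mathcal L_{ij}=0$ otherwise. The quantity $\varphi(\mathcal G,\mathcal X)$ is the bandwidth of the Laplacian of $\mathcal G$ after relabeling the vertices by $\pi$; equivalently, $\varphi(\mathcal G,\mathcal X)=\max_{(i,j)\in\mathcal E}|\pi(i)-\pi(j)|$ (equal to $0$ if $\mathcal E=\emptyset$). $\mathcal X$ is indexed by $\mathcal V$, and $|\mathcal X\cap R|$ denotes the number of vertices $i\in\mathcal V$ with $x_i\in R$ (positions counted with multiplicity). *)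

theory Defs
  imports "HOL-Analysis.Analysis" "HOL-Library.Fun_Lexorder"
begin

text \<open>
  Vertices are the numbers \<open>1, \<dots>, n\<close>; positions are functions on \<^typ>\<open>nat\<close> of which only the
  values on \<open>{1..n}\<close> matter.  The coordinates of a point of \<open>real ^ 'd\<close> are ordered by the
  linear order on the index type \<open>'d\<close>, so that the first coordinate is the one at \<open>Min UNIV\<close>.
\<close>

text \<open>A symmetric relation is an undirected graph; self-loops are permitted and have no effect below.\<close>

definition undirected_graph :: "nat \<Rightarrow> (nat \<times> nat) set \<Rightarrow> bool" where
  "undirected_graph n E \<longleftrightarrow> E \<subseteq> {1..n} \<times> {1..n} \<and> sym E"

definition geometric_graph ::
  "nat \<Rightarrow> (nat \<times> nat) set \<Rightarrow> (nat \<Rightarrow> real ^ 'd) \<Rightarrow> real \<Rightarrow> bool" where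
  "geometric_graph n E x r \<longleftrightarrow>
     (\<forall>i\<in>{1..n}. \<forall>j\<in>{1..n}. i \<noteq> j \<longrightarrow> ((i, j) \<in> E \<longleftrightarrow> norm (x i - x j) \<le> r))"

definition laplacian :: "nat \<Rightarrow> (nat \<times> nat) set \<Rightarrow> nat \<Rightarrow> nat \<Rightarrow> real" where
  "laplacian n E i j =
     (if i = j then real (card {k \<in> {1..n}. k \<noteq> i \<and> (i, k) \<in> E})
      else if (i, j) \<in> E then -1 else 0)"

text \<open>Entries are indexed by \<open>{1..n}\<close>; inserting \<open>0\<close> only matters for the zero matrix.\<close>

definition bandwidth :: "nat \<Rightarrow> (nat \<Rightarrow> nat \<Rightarrow> real) \<Rightarrow> nat" where
  "bandwidth n A =
     Max (insert 0 {nat \<bar>int i - int j\<bar> | i j. i \<in> {1..n} \<and> j \<in> {1..n} \<and> A i j \<noteq> 0})"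

definition lex_le :: "real ^ 'd::{finite,linorder} \<Rightarrow> real ^ 'd::{finite,linorder} \<Rightarrow> bool" where
  "lex_le u v \<longleftrightarrow> u = v \<or> less_fun (vec_nth u) (vec_nth v)"

text \<open>
  The possible outputs of the relabeling algorithm: \<open>vs\<close> lists the vertices in sorted order, and
  \<open>\<pi>\<close> sends each vertex to its (one-based) rank.  The order of vertices with identical positions
  is not determined, which is why this is a relation rather than a function of the positions.
\<close>

definition sorting_relabeling ::
  "nat \<Rightarrow> (nat \<Rightarrow> real ^ 'd::{finite,linorder}) \<Rightarrow> (nat \<Rightarrow> nat) \<Rightarrow> bool" where
  "sorting_relabeling n x \<pi> \<longleftrightarrow>
     (\<exists>vs. distinct vs \<and> set vs = {1..n} \<and> sorted_wrt (\<lambda>i j. lex_le (x i) (x j)) vs \<and>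
           (\<forall>k<length vs. \<pi> (vs ! k) = Suc k))"

definition relabeled_edges :: "(nat \<Rightarrow> nat) \<Rightarrow> (nat \<times> nat) set \<Rightarrow> (nat \<times> nat) set" where
  "relabeled_edges \<pi> E = map_prod \<pi> \<pi> ` E"

definition relabeled_bandwidth :: "nat \<Rightarrow> (nat \<times> nat) set \<Rightarrow> (nat \<Rightarrow> nat) \<Rightarrow> nat" where
  "relabeled_bandwidth n E \<pi> = bandwidth n (laplacian n (relabeled_edges \<pi> E))"

definition x_slab :: "real \<Rightarrow> real \<Rightarrow> (real ^ 'd::{finite,linorder}) set" where
  "x_slab a b = {p. a \<le> p $ Min UNIV \<and> p $ Min UNIV \<le> b}"

definition phi_max :: "nat \<Rightarrow> (nat \<Rightarrow> real ^ 'd::{finite,linorder}) \<Rightarrow> real \<Rightarrow> nat" where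
  "phi_max n x r = Max (range (\<lambda>a. card {i \<in> {1..n}. x i \<in> x_slab a (a + r)}))"

end

theory Submission
  imports Defs
begin

text \<open>
  Sorting lexicographically makes the first coordinate nondecreasing along the sorted list.  If an
  edge joins the vertices of ranks \<open>k \<le> l\<close>, their first coordinates differ by at most \<open>r\<close>, so all
  \<open>l - k + 1\<close> vertices ranked between them lie in one slab of width \<open>r\<close>.
\<close>

text \<open>The index deciding a strict comparison is either \<open>Min UNIV\<close>, where the
  inequality is strict, or a later one, and then the coordinates at \<open>Min UNIV\<close>
  agree.\<close>

lemma lex_le_imp_first_coord_le:
  assumes "lex_le u v"
  shows "u $ Min UNIV \<le> v $ Min UNIV"
proof (cases "u = v")
  case False
  then obtain k where k: "u $ k < v $ k" "\<And>l. l < k \<Longrightarrow> u $ l = v $ l"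
    using assms by (auto simp: lex_le_def less_fun_def)
  have "Min UNIV \<le> k" by simp
  then consider "Min UNIV < k" | "Min UNIV = k" by (auto simp: le_less)
  then show ?thesis using k(1) k(2)[of "Min UNIV"] by cases simp_all
qed simp

text \<open>\<open>Max\<close> bounds the members of a finite set only. Here \<open>a\<close> runs
  over all reals, but the counts never exceed \<open>n\<close>, so they take finitely many
  values.\<close>

lemma card_slab_le_phi_max:
  "card {i \<in> {1..n}. x i \<in> x_slab a (a + r)} \<le> phi_max n x r"
proof -
  have "range (\<lambda>a. card {i \<in> {1..n}. x i \<in> x_slab a (a + r)}) \<subseteq> {..n}"
  proof clarsimp
    fix a
    have "card {i \<in> {1..n}. x i \<in> x_slab a (a + r)} \<le> card {1..n}"
      by (intro card_mono) auto
    then show "card {i. Suc 0 \<le> i \<and> i \<le> n \<and> x i \<in> x_slab a (a + r)} \<le> n"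
      by simp
  qed
  then have "finite (range (\<lambda>a. card {i \<in> {1..n}. x i \<in> x_slab a (a + r)}))"
    by (rule finite_subset) simp
  then show ?thesis by (simp add: phi_max_def)
qed

lemma rank_difference_le_phi_max:
  fixes x :: "nat \<Rightarrow> real ^ 'd::{finite,linorder}"
  assumes "distinct vs" "set vs = {1..n}"
    and sorted: "sorted_wrt (\<lambda>i j. lex_le (x i) (x j)) vs"
    and "k \<le> l" "l < length vs"
    and close: "norm (x (vs ! k) - x (vs ! l)) \<le> r"
  shows "l - k \<le> phi_max n x r"
proof -
  \<comment> \<open>The slab starts at the lower-ranked endpoint, so monotonicity alone gives the
    left bound for every vertex ranked from \<open>k\<close> to \<open>l\<close>.\<close>
  define a where "a = x (vs ! k) $ Min UNIV"
  have mono: "x (vs ! p) $ Min UNIV \<le> x (vs ! q) $ Min UNIV" if "p \<le> q" "q < length vs" for p q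
    using that sorted_wrt_nth_less[OF sorted, of p q]
    by (cases "p = q") (auto intro: lex_le_imp_first_coord_le)
  have "\<bar>a - x (vs ! l) $ Min UNIV\<bar> \<le> r"
    using component_le_norm_cart[of "x (vs ! k) - x (vs ! l)" "Min UNIV"] close
    by (simp add: a_def)
  then have last: "x (vs ! l) $ Min UNIV \<le> a + r" by linarith
  have "(!) vs ` {k..l} \<subseteq> {i \<in> {1..n}. x i \<in> x_slab a (a + r)}"
  proof
    fix i assume "i \<in> (!) vs ` {k..l}"
    then obtain p where p: "k \<le> p" "p \<le> l" "i = vs ! p" by auto
    then have "i \<in> {1..n}" using assms(2,5) nth_mem[of p vs] by simp
    moreover have "a \<le> x i $ Min UNIV" using mono[of k p] p assms(5) by (simp add: a_def)
    moreover have "x i $ Min UNIV \<le> a + r" using mono[of p l] p assms(5) last by simp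
    ultimately show "i \<in> {i \<in> {1..n}. x i \<in> x_slab a (a + r)}" by (simp add: x_slab_def)
  qed
  then have "card ((!) vs ` {k..l}) \<le> card {i \<in> {1..n}. x i \<in> x_slab a (a + r)}"
    by (intro card_mono) auto
  \<comment> \<open>Vertices are counted, not points, so distinctness of \<open>vs\<close> suffices
    even where positions coincide.\<close>
  moreover have "inj_on ((!) vs) {k..l}"
    using assms(1,5) by (intro inj_on_nth) auto
  ultimately have "Suc l - k \<le> card {i \<in> {1..n}. x i \<in> x_slab a (a + r)}"
    by (simp add: card_image)
  also have "\<dots> \<le> phi_max n x r" by (rule card_slab_le_phi_max)
  finally show ?thesis by simp
qed

lemma laplacian_off_diagonal_nonzero_iff:
  "i \<noteq> j \<Longrightarrow> laplacian n E i j \<noteq> 0 \<longleftrightarrow> (i, j) \<in> E"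
  by (simp add: laplacian_def)

text \<open>Diagonal entries contribute distance 0, so only off-diagonal ones have to be checked;
  the degrees in a Laplacian never matter.\<close>

lemma bandwidth_le:
  assumes "\<And>i j. i \<in> {1..n} \<Longrightarrow> j \<in> {1..n} \<Longrightarrow> i \<noteq> j \<Longrightarrow> A i j \<noteq> 0 \<Longrightarrow> nat \<bar>int i - int j\<bar> \<le> b"
  shows "bandwidth n A \<le> b"
proof -
  have "{nat \<bar>int i - int j\<bar> | i j. i \<in> {1..n} \<and> j \<in> {1..n} \<and> A i j \<noteq> 0} \<subseteq>
    (\<lambda>(i, j). nat \<bar>int i - int j\<bar>) ` ({1..n} \<times> {1..n})" by auto
  then have "finite {nat \<bar>int i - int j\<bar> | i j. i \<in> {1..n} \<and> j \<in> {1..n} \<and> A i j \<noteq> 0}"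
    by (rule finite_subset) simp
  moreover have "nat \<bar>int i - int j\<bar> \<le> b"
    if "i \<in> {1..n}" "j \<in> {1..n}" "A i j \<noteq> 0" for i j
    using assms[OF that(1,2) _ that(3)] by (cases "i = j") auto
  ultimately show ?thesis unfolding bandwidth_def by (subst Max_le_iff) auto
qed

theorem theorem1:
  fixes n :: nat and E :: "(nat \<times> nat) set"
    and x :: "nat \<Rightarrow> real ^ 'd::{finite,linorder}" and r :: real and \<pi> :: "nat \<Rightarrow> nat"
  assumes "n \<ge> 1"
    and "r > 0"
    and "undirected_graph n E"
    and "geometric_graph n E x r"
    and "sorting_relabeling n x \<pi>"
  shows "relabeled_bandwidth n E \<pi> \<le> phi_max n x r"
proof -
  obtain vs where vs: "distinct vs" "set vs = {1..n}"
      "sorted_wrt (\<lambda>i j. lex_le (x i) (x j)) vs"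
    and rank: "\<And>k. k < length vs \<Longrightarrow> \<pi> (vs ! k) = Suc k"
    using assms(5) by (auto simp: sorting_relabeling_def)
  show ?thesis unfolding relabeled_bandwidth_def
  proof (rule bandwidth_le)
    fix i j assume "i \<noteq> j" "laplacian n (relabeled_edges \<pi> E) i j \<noteq> 0"
    then obtain u v where uv: "(u, v) \<in> E" "i = \<pi> u" "j = \<pi> v"
      by (auto simp: laplacian_off_diagonal_nonzero_iff relabeled_edges_def)
    then have verts: "u \<in> {1..n}" "v \<in> {1..n}"
      using assms(3) by (auto simp: undirected_graph_def)
    then obtain k l where k: "k < length vs" "u = vs ! k" and l: "l < length vs" "v = vs ! l"
      unfolding vs(2)[symmetric] in_set_conv_nth by blast
    \<comment> \<open>This excludes self-loops, about which \<open>geometric_graph\<close> says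
      nothing.\<close>
    have "u \<noteq> v" using \<open>i \<noteq> j\<close> uv by auto
    then have close: "norm (x u - x v) \<le> r"
      using assms(4) verts uv(1) by (simp add: geometric_graph_def)
    \<comment> \<open>Either endpoint may have the lower rank. One of the two truncated differences
      is 0 and the other is the distance.\<close>
    have "k - l \<le> phi_max n x r \<and> l - k \<le> phi_max n x r"
      using rank_difference_le_phi_max[OF vs, of k l r] rank_difference_le_phi_max[OF vs, of l k r]
        close k l by (cases k l rule: le_cases) (auto simp: norm_minus_commute)
    \<comment> \<open>Ranks are one-based and list positions zero-based; the shift cancels in the
      difference.\<close>
    moreover have "i = Suc k" "j = Suc l" using uv rank k l by auto
    ultimately show "nat \<bar>int i - int j\<bar> \<le> phi_max n x r" by linarith
  qed
qed

end
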